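(* Let $f$ be a continuous surjective map on a metric space $X$. Then every periodic specification point of $f$ is a Devaney chaotic point of $f$.
   Context: Let $f$ be a continuous map on a metric space $(X,d)$ and $x\in X$; $\mathrm{Per}(f)$ is the set of periodic points of $f$. $x$ is a periodic specification point of $f$ if for every $\epsilon>0$ there is a positive integer $M(\epsilon)$ such that for any finite sequence $x=x_1,x_2,\dots,x_k$ in $X$ (whose first term is $x$) and any integers $0\le a_1\le b_1<a_2\le b_2<\dots<a_k\le b_k$ with $a_j-b_{j-1}\ge M(\epsilon)$ for all $2\le j\le k$, there is $y\in\mathrm{Per}(f)$ with $d(f^i(y),f^i(x_j))<\epsilon$ for all $a_j\le i\le b_j$ and all $1\le j\le k$. $x$ is a topologically transitive point of $f$ if for any open set $U$ containing $x$ and any non-empty open set $V$ there is a positive integer $n$ with $f^n(U)\cap V\ne\emptyset$. $f$ has a dense set of periodic points at $x$ if every deleted open set of $x$ (a set $U\setminus\{x\}$ with $U$ open and $x\in U$) contains a periodic point of $f$. $x$ is a sensitive point of $f$ if there is $\delta_x>0$ such that for every open set $U$ containing $x$ there are $y\in U$ and a positive integer $n$ with $d(f^n(x),f^n(y))>\delta_x$. $x$ is a Devaney chaotic point of $f$ if $x$ is a topologically transitive point of $f$, $f$ has a dense set of periodic points at $x$, and $x$ is a sensitive point of $f$.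
   Formalization: The metric space X is assumed to have at least two points; on a one-point space the identity's only point is a periodic specification point but is not sensitive and its deleted open set contains no periodic point. *)

theory Defs
  imports Complex_Main
begin

text \<open>
  The metric space $X$ is the whole type \<open>'a\<close>, of class \<open>metric_space\<close>;
  $f^n$ is \<open>f ^^ n\<close>.
\<close>

definition Per :: "('a \<Rightarrow> 'a) \<Rightarrow> 'a set" where
  "Per f = {y. \<exists>n>0. (f ^^ n) y = y}"

text \<open>
  The sequences \<open>xs\<close>, \<open>a\<close>, \<open>b\<close> are indexed by \<open>1..k\<close>; their values elsewhere are irrelevant.
  The gap condition is written additively because subtraction on \<open>nat\<close> is truncated.
\<close>

definition periodic_specification_point :: "('a::metric_space \<Rightarrow> 'a) \<Rightarrow> 'a \<Rightarrow> bool" where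
  "periodic_specification_point f x \<longleftrightarrow>
    (\<forall>\<epsilon>>0. \<exists>M::nat. M > 0 \<and>
      (\<forall>(k::nat) (xs :: nat \<Rightarrow> 'a) (a :: nat \<Rightarrow> nat) (b :: nat \<Rightarrow> nat).
        k \<ge> 1 \<longrightarrow> xs 1 = x \<longrightarrow>
        (\<forall>j\<in>{1..k}. a j \<le> b j) \<longrightarrow>
        (\<forall>j\<in>{2..k}. b (j - 1) < a j) \<longrightarrow>
        (\<forall>j\<in>{2..k}. a j \<ge> b (j - 1) + M) \<longrightarrow>
        (\<exists>y\<in>Per f. \<forall>j\<in>{1..k}. \<forall>i\<in>{a j..b j}. dist ((f ^^ i) y) ((f ^^ i) (xs j)) < \<epsilon>)))"

definition transitive_point :: "('a::topological_space \<Rightarrow> 'a) \<Rightarrow> 'a \<Rightarrow> bool" where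
  "transitive_point f x \<longleftrightarrow>
    (\<forall>U V. open U \<longrightarrow> x \<in> U \<longrightarrow> open V \<longrightarrow> V \<noteq> {} \<longrightarrow>
      (\<exists>n>0. (f ^^ n) ` U \<inter> V \<noteq> {}))"

definition dense_periodic_at :: "('a::topological_space \<Rightarrow> 'a) \<Rightarrow> 'a \<Rightarrow> bool" where
  "dense_periodic_at f x \<longleftrightarrow>
    (\<forall>U. open U \<longrightarrow> x \<in> U \<longrightarrow> (U - {x}) \<inter> Per f \<noteq> {})"

definition sensitive_point :: "('a::metric_space \<Rightarrow> 'a) \<Rightarrow> 'a \<Rightarrow> bool" where
  "sensitive_point f x \<longleftrightarrow>
    (\<exists>\<delta>>0. \<forall>U. open U \<longrightarrow> x \<in> U \<longrightarrow>
      (\<exists>y\<in>U. \<exists>n>0. dist ((f ^^ n) x) ((f ^^ n) y) > \<delta>))"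

definition devaney_chaotic_point :: "('a::metric_space \<Rightarrow> 'a) \<Rightarrow> 'a \<Rightarrow> bool" where
  "devaney_chaotic_point f x \<longleftrightarrow>
    transitive_point f x \<and> dense_periodic_at f x \<and> sensitive_point f x"

text \<open>
  A one-point space has to be excluded in the theorem: its only point is a periodic
  specification point of the identity, but it is neither a sensitive point nor does its
  (empty) deleted neighbourhood contain a periodic point.
\<close>

end

theory Submission
  imports Defs
begin

text \<open>
  A specification with only two one-point segments, at the times \<open>0\<close> and \<open>n\<close>, already
  forces chaos. Since \<open>f ^^ n\<close> is surjective, the second segment can be taken on the
  orbit of a preimage under \<open>f ^^ n\<close> of any given point \<open>z\<close>, so
  arbitrarily close to \<open>x\<close> there is a periodic point that lands near \<open>z\<close> at time \<open>n\<close>, where \<open>n\<close> depends on the required accuracy but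
  not on \<open>z\<close> (lemma \<open>periodic_point_near_hitting\<close>). Transitivity is this with \<open>z \<in> V\<close>.

  Because \<open>n\<close> is the same for all targets, two distinct targets \<open>u\<close> and \<open>v\<close> give two
  periodic points near \<open>x\<close> whose images at one common time are far apart. The orbit of \<open>x\<close>
  cannot be close to both at that time, so one of the two separates from it by an amount
  that depends only on \<open>dist u v\<close> (lemma \<open>periodic_point_near_separating\<close>). This is
  sensitivity, and since a point that separates from \<open>x\<close> differs from \<open>x\<close>, it also puts a
  periodic point in every deleted neighbourhood of \<open>x\<close>, even when \<open>x\<close> is itself
  periodic.
\<close>

text \<open>
  The order of the quantifiers matters: the time \<open>n\<close> is chosen before the target \<open>z\<close>.
\<close>

lemma periodic_point_near_hitting:
  fixes f :: "'a::metric_space \<Rightarrow> 'a"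
  assumes spec: "periodic_specification_point f x" and surj: "surj f" and "e > 0"
  obtains n where "n > 0"
    and "\<And>z. \<exists>y\<in>Per f. dist y x < e \<and> dist ((f ^^ n) y) z < e"
proof -
  from spec \<open>e > 0\<close> obtain M :: nat where "M > 0" and
    M: "\<And>(k::nat) (xs :: nat \<Rightarrow> 'a) (a :: nat \<Rightarrow> nat) (b :: nat \<Rightarrow> nat).
        k \<ge> 1 \<Longrightarrow> xs 1 = x \<Longrightarrow> \<forall>j\<in>{1..k}. a j \<le> b j \<Longrightarrow>
        \<forall>j\<in>{2..k}. b (j - 1) < a j \<Longrightarrow> \<forall>j\<in>{2..k}. a j \<ge> b (j - 1) + M \<Longrightarrow>
        \<exists>y\<in>Per f. \<forall>j\<in>{1..k}. \<forall>i\<in>{a j..b j}. dist ((f ^^ i) y) ((f ^^ i) (xs j)) < e"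
    unfolding periodic_specification_point_def by metis
  have "\<exists>y\<in>Per f. dist y x < e \<and> dist ((f ^^ M) y) z < e" for z
  proof -
    have "surj (f ^^ M)"
      using surj by (rule surj_fn)
    then obtain w where w: "(f ^^ M) w = z"
      by (metis surjD)
    define xs where "xs j = (if j = 1 then x else w)" for j :: nat
    define t where "t j = (if j = 1 then 0 else M)" for j :: nat
    have "\<exists>y\<in>Per f. \<forall>j\<in>{1..2}. \<forall>i\<in>{t j..t j}. dist ((f ^^ i) y) ((f ^^ i) (xs j)) < e"
      by (rule M) (use \<open>M > 0\<close> in \<open>auto simp: xs_def t_def\<close>)
    then obtain y where "y \<in> Per f"
      and y: "\<And>j. j \<in> {1..2} \<Longrightarrow> dist ((f ^^ t j) y) ((f ^^ t j) (xs j)) < e"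
      by auto
    from y[of 1] y[of 2] have "dist y x < e" "dist ((f ^^ M) y) z < e"
      using w by (simp_all add: xs_def t_def)
    with \<open>y \<in> Per f\<close> show ?thesis by blast
  qed
  with \<open>M > 0\<close> show thesis by (rule that)
qed

lemma periodic_point_near_separating:
  fixes f :: "'a::metric_space \<Rightarrow> 'a" and u v :: 'a
  assumes spec: "periodic_specification_point f x" and surj: "surj f"
    and "e > 0" and "u \<noteq> v"
  obtains y n where "y \<in> Per f" "dist y x < e" "n > 0"
    "dist ((f ^^ n) x) ((f ^^ n) y) > dist u v / 4"
proof -
  \<comment> \<open>Images within a quarter of \<open>dist u v\<close> of \<open>u\<close> and of \<open>v\<close> are more than half of
    \<open>dist u v\<close> apart, so no point is within a quarter of \<open>dist u v\<close> of both.\<close>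
  define r where "r = min e (dist u v / 4)"
  have "r > 0" "r \<le> e" "r \<le> dist u v / 4"
    using \<open>e > 0\<close> \<open>u \<noteq> v\<close> by (auto simp: r_def)
  obtain n where "n > 0"
    and hit: "\<And>z. \<exists>y\<in>Per f. dist y x < r \<and> dist ((f ^^ n) y) z < r"
    using periodic_point_near_hitting[OF spec surj \<open>r > 0\<close>] by blast
  obtain p where p: "p \<in> Per f" "dist p x < r" "dist ((f ^^ n) p) u < r"
    using hit by blast
  obtain q where q: "q \<in> Per f" "dist q x < r" "dist ((f ^^ n) q) v < r"
    using hit by blast
  have "dist u v \<le> dist ((f ^^ n) p) u + dist ((f ^^ n) x) ((f ^^ n) p)
      + dist ((f ^^ n) x) ((f ^^ n) q) + dist ((f ^^ n) q) v"
    using dist_triangle[of u v "(f ^^ n) x"]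
      dist_triangle[of u "(f ^^ n) x" "(f ^^ n) p"]
      dist_triangle[of "(f ^^ n) x" v "(f ^^ n) q"]
    by (simp add: dist_commute)
  with p(3) q(3) \<open>r \<le> dist u v / 4\<close>
  have "dist ((f ^^ n) x) ((f ^^ n) p) > dist u v / 4 \<or>
        dist ((f ^^ n) x) ((f ^^ n) q) > dist u v / 4"
    by linarith
  moreover have "dist p x < e" "dist q x < e"
    using p(2) q(2) \<open>r \<le> e\<close> by linarith+
  ultimately show thesis
    using that p(1) q(1) \<open>n > 0\<close> by blast
qed

theorem mainTheorem3:
  fixes f :: "'a::metric_space \<Rightarrow> 'a" and x :: 'a
  assumes nontrivial: "\<exists>u v :: 'a. u \<noteq> v"
    and "continuous_on UNIV f" and "surj f"
    and "periodic_specification_point f x"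
  shows "devaney_chaotic_point f x"
proof -
  obtain u v :: 'a where "u \<noteq> v"
    using nontrivial by blast
  have sep: "\<exists>y\<in>U. y \<in> Per f \<and> (\<exists>n>0. dist ((f ^^ n) x) ((f ^^ n) y) > dist u v / 4)"
    if "open U" "x \<in> U" for U
  proof -
    obtain e where "e > 0" "\<And>y. dist y x < e \<Longrightarrow> y \<in> U"
      using \<open>open U\<close> \<open>x \<in> U\<close> by (meson open_dist)
    then show ?thesis
      using periodic_point_near_separating[OF assms(4,3) \<open>e > 0\<close> \<open>u \<noteq> v\<close>] by metis
  qed
  have "transitive_point f x"
    unfolding transitive_point_def
  proof (intro allI impI)
    fix U V :: "'a set"
    assume "open U" "x \<in> U" "open V" "V \<noteq> {}"
    obtain z where "z \<in> V"
      using \<open>V \<noteq> {}\<close> by blast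
    obtain d where "d > 0" and d: "\<And>y. dist y x < d \<Longrightarrow> y \<in> U"
      using \<open>open U\<close> \<open>x \<in> U\<close> by (meson open_dist)
    obtain e where "e > 0" and e: "\<And>y. dist y z < e \<Longrightarrow> y \<in> V"
      using \<open>open V\<close> \<open>z \<in> V\<close> by (meson open_dist)
    have "min d e > 0"
      using \<open>d > 0\<close> \<open>e > 0\<close> by simp
    then obtain n where "n > 0"
      and hit: "\<And>w. \<exists>y\<in>Per f. dist y x < min d e \<and> dist ((f ^^ n) y) w < min d e"
      using periodic_point_near_hitting[OF assms(4,3)] by blast
    then obtain y where "dist y x < min d e" "dist ((f ^^ n) y) z < min d e"
      by blast
    then have "y \<in> U" "(f ^^ n) y \<in> V"
      by (auto intro: d e)
    with \<open>n > 0\<close> show "\<exists>n>0. (f ^^ n) ` U \<inter> V \<noteq> {}"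
      by blast
  qed
  moreover have "dense_periodic_at f x"
    unfolding dense_periodic_at_def
  proof (intro allI impI)
    fix U :: "'a set"
    assume "open U" "x \<in> U"
    then obtain y n where y: "y \<in> U" "y \<in> Per f"
      and "dist ((f ^^ n) x) ((f ^^ n) y) > dist u v / 4"
      using sep by blast
    then have "y \<noteq> x"
      by auto
    with y show "(U - {x}) \<inter> Per f \<noteq> {}"
      by blast
  qed
  moreover have "sensitive_point f x"
    unfolding sensitive_point_def
  proof (intro exI[of _ "dist u v / 4"] conjI allI impI)
    show "dist u v / 4 > 0"
      using \<open>u \<noteq> v\<close> by simp
  qed (use sep in blast)
  ultimately show ?thesis
    unfolding devaney_chaotic_point_def by blast
qed

end
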